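(* Let $M$ be the free $\mathbb{Z}$-module with basis $x_1,x_2,\ldots$. There is a unique map $\tilde q$ from finite simple graphs (with at least one vertex) to $M$ such that: (i) if $G$ contains an edge $ab$ then $\tilde q(G)=\tilde q(G-a)+\tilde q(G^{ab}-b)$; (ii) for the edgeless graph $E_n$ on $n\ge1$ vertices, $\tilde q(E_n)=x_n$.
   Context: For a graph $G$ and distinct vertices $a,b$, the pivot $G^{ab}$ is obtained by partitioning the vertices other than $a,b$ into (1) adjacent to $a$ only, (2) adjacent to $b$ only, (3) adjacent to both, (4) adjacent to neither, and toggling the adjacency of every pair $\{x,y\}$ with $x,y$ in two different classes among (1),(2),(3), leaving other adjacencies unchanged. *)

theory Defs
  imports
    "Graph_Theory.Pair_Digraph"
    "Graph_Theory.Digraph_Isomorphism"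
    "HOL-Algebra.Free_Abelian_Groups"
    "HOL-Library.FuncSet"
begin

(* A locale instance of pair_graph is a finite simple graph: an undirected edge ab is
   represented by the two arcs (a,b) and (b,a). *)
definition nonempty_graphs :: "'a pair_pre_digraph set" where
  "nonempty_graphs = {G. pair_graph G \<and> pverts G \<noteq> {}}"

definition delete_vertex :: "'a pair_pre_digraph \<Rightarrow> 'a \<Rightarrow> 'a pair_pre_digraph" where
  "delete_vertex G v =
     \<lparr>pverts = pverts G - {v}, parcs = {e \<in> parcs G. fst e \<noteq> v \<and> snd e \<noteq> v}\<rparr>"

lemma with_proj_delete_vertex:
  "with_proj (delete_vertex G v) = pre_digraph.del_vert (with_proj G) v"
  by (simp add: delete_vertex_def with_proj_def pre_digraph.del_vert_def)

(* (True, False), (False, True), (True, True), (False, False) are the classes of vertices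
   adjacent to a only, to b only, to both, and to neither. *)
definition pivot_class :: "'a pair_pre_digraph \<Rightarrow> 'a \<Rightarrow> 'a \<Rightarrow> 'a \<Rightarrow> bool \<times> bool" where
  "pivot_class G a b v = ((v, a) \<in> parcs G, (v, b) \<in> parcs G)"

definition pivot_pairs :: "'a pair_pre_digraph \<Rightarrow> 'a \<Rightarrow> 'a \<Rightarrow> 'a rel" where
  "pivot_pairs G a b =
     {(x, y). x \<in> pverts G - {a, b} \<and> y \<in> pverts G - {a, b} \<and>
        pivot_class G a b x \<noteq> (False, False) \<and> pivot_class G a b y \<noteq> (False, False) \<and>
        pivot_class G a b x \<noteq> pivot_class G a b y}"

definition pivot :: "'a pair_pre_digraph \<Rightarrow> 'a \<Rightarrow> 'a \<Rightarrow> 'a pair_pre_digraph" where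
  "pivot G a b =
     \<lparr>pverts = pverts G,
      parcs = (parcs G - pivot_pairs G a b) \<union> (pivot_pairs G a b - parcs G)\<rparr>"

(* The module M is the carrier of free_Abelian_group {1..}, with basis x_n = frag_of n.
   The extensional function space makes uniqueness refer to the values on graphs only. *)
definition interlace_map :: "('a pair_pre_digraph \<Rightarrow> (nat \<Rightarrow>\<^sub>0 int)) \<Rightarrow> bool" where
  "interlace_map q \<longleftrightarrow>
     q \<in> nonempty_graphs \<rightarrow>\<^sub>E carrier (free_Abelian_group {1..}) \<and>
     (\<forall>G\<in>nonempty_graphs. \<forall>a b. (a, b) \<in> parcs G \<longrightarrow>
        q G = q (delete_vertex G a) + q (delete_vertex (pivot G a b) b)) \<and>
     (\<forall>G\<in>nonempty_graphs. parcs G = {} \<longrightarrow> q G = frag_of (card (pverts G)))"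

lemma delete_vertex_nonempty_graphs:
  assumes "G \<in> nonempty_graphs" "u \<in> pverts G" "u \<noteq> v"
  shows "delete_vertex G v \<in> nonempty_graphs"
proof -
  interpret pair_graph G using assms by (simp add: nonempty_graphs_def)
  have "pair_graph (delete_vertex G v)"
    using pair_finite_verts pair_finite_arcs no_loops' arcs_symmetric
    by unfold_locales
      (auto simp: delete_vertex_def symmetric_def sym_def wellformed')
  then show ?thesis using assms by (auto simp: nonempty_graphs_def delete_vertex_def)
qed

lemma pivot_nonempty_graphs:
  assumes "G \<in> nonempty_graphs"
  shows "pivot G a b \<in> nonempty_graphs"
proof -
  interpret pair_graph G using assms by (simp add: nonempty_graphs_def)
  have "pivot_pairs G a b \<subseteq> pverts G \<times> pverts G"
    by (auto simp: pivot_pairs_def)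
  then have "finite (pivot_pairs G a b)"
    using pair_finite_verts by (meson finite_SigmaI finite_subset)
  moreover have "(y, x) \<in> pivot_pairs G a b" if "(x, y) \<in> pivot_pairs G a b" for x y
    using that by (auto simp: pivot_pairs_def)
  moreover have "x \<noteq> y" "x \<in> pverts G" "y \<in> pverts G" if "(x, y) \<in> pivot_pairs G a b" for x y
    using that by (auto simp: pivot_pairs_def)
  ultimately have "pair_graph (pivot G a b)"
    using pair_finite_verts pair_finite_arcs no_loops' arcs_symmetric
    by unfold_locales
      (auto simp: pivot_def symmetric_def sym_def wellformed')
  then show ?thesis using assms by (auto simp: nonempty_graphs_def pivot_def)
qed

end

theory Submission
  imports Defs
begin

text \<open>
  Uniqueness and isomorphism invariance are easy once a closed formula is known; the point is
  existence. Reading \<open>x\<^sub>n\<close> as \<open>x^n\<close>, the map is the sum of \<open>(x - 1)^null(A[S])\<close> over all vertex sets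
  \<open>S\<close>, where \<open>A\<close> is the adjacency matrix over GF(2). The sets avoiding \<open>a\<close> contribute the value at
  \<open>G - a\<close>. For the sets containing \<open>a\<close>, eliminating the coordinates \<open>a\<close> and \<open>b\<close> of a kernel vector
  (a Schur complement) shows that \<open>R \<union> {a, b}\<close> has the same nullity in \<open>G\<close> as \<open>R\<close> in the pivot, and
  that \<open>R \<union> {a}\<close> has the same nullity in both graphs.
\<close>

section \<open>Kernels and nullities over GF(2)\<close>

text \<open>A vector over GF(2) is encoded as its support \<open>X\<close>. The parity of this count
  is then entry \<open>v\<close> of the adjacency matrix applied to the vector.\<close>

definition nbr_count :: "'a pair_pre_digraph \<Rightarrow> 'a set \<Rightarrow> 'a \<Rightarrow> nat" where
  "nbr_count G X v = (\<Sum>x\<in>X. of_bool ((v, x) \<in> parcs G))"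

definition gf2_kernel :: "'a pair_pre_digraph \<Rightarrow> 'a set \<Rightarrow> 'a set set" where
  "gf2_kernel G S = {X. X \<subseteq> S \<and> (\<forall>v\<in>S. even (nbr_count G X v))}"

(* That the kernel is a vector space, so that its size is a power of 2, is never needed: a junk
   value of the_inv would still depend on the size only. *)
definition gf2_nullity :: "'a pair_pre_digraph \<Rightarrow> 'a set \<Rightarrow> nat" where
  "gf2_nullity G S = the_inv (\<lambda>k. 2 ^ k) (card (gf2_kernel G S))"

lemma even_sum_cong:
  fixes f g :: "'b \<Rightarrow> nat"
  assumes "\<And>x. x \<in> A \<Longrightarrow> even (f x) \<longleftrightarrow> even (g x)"
  shows "even (sum f A) \<longleftrightarrow> even (sum g A)"
  using assms by (induction A rule: infinite_finite_induct) auto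

lemma nbr_count_remove:
  assumes "finite X"
  shows "nbr_count G X v =
    nbr_count G (X - {a}) v + of_bool (a \<in> X) * of_bool ((v, a) \<in> parcs G)"
  using assms by (cases "a \<in> X") (simp_all add: nbr_count_def sum.remove del: sum_of_bool_eq)

lemma gf2_nullity_eqI:
  "card (gf2_kernel G S) = card (gf2_kernel H T) \<Longrightarrow> gf2_nullity G S = gf2_nullity H T"
  by (simp add: gf2_nullity_def)

text \<open>The kernel only sees arcs inside \<open>S\<close>. Hence the terms of the formula for a
  vertex-deleted graph can be computed in the graph before deletion.\<close>

lemma gf2_nullity_delete_vertex:
  assumes "v \<notin> S"
  shows "gf2_nullity (delete_vertex G v) S = gf2_nullity G S"
proof -
  have "nbr_count (delete_vertex G v) X u = nbr_count G X u" if "X \<subseteq> S" "u \<in> S" for X u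
    using that assms unfolding nbr_count_def
    by (intro sum.cong) (auto simp: delete_vertex_def)
  then have "gf2_kernel (delete_vertex G v) S = gf2_kernel G S"
    by (auto simp: gf2_kernel_def)
  then show ?thesis by (simp add: gf2_nullity_def)
qed

text \<open>The zero matrix annihilates every vector, so the kernel has 2^|S| elements.\<close>

lemma gf2_nullity_edgeless:
  assumes "parcs G = {}" "finite S"
  shows "gf2_nullity G S = card S"
proof -
  have "gf2_kernel G S = Pow S"
    using assms by (auto simp: gf2_kernel_def nbr_count_def)
  moreover have "inj (\<lambda>k::nat. 2 ^ k :: nat)"
    by (rule injI) simp
  ultimately show ?thesis
    using assms the_inv_f_f by (fastforce simp: gf2_nullity_def card_Pow)
qed

text \<open>Taking images under \<open>f\<close> is a bijection between the two kernels. This serves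
  isomorphism invariance.\<close>

lemma gf2_nullity_image:
  assumes inj: "inj_on f V" and "S \<subseteq> V"
    and arcs: "\<And>x y. x \<in> V \<Longrightarrow> y \<in> V \<Longrightarrow> (f x, f y) \<in> parcs H \<longleftrightarrow> (x, y) \<in> parcs G"
  shows "gf2_nullity H (f ` S) = gf2_nullity G S"
proof -
  have count: "nbr_count H (f ` X) (f v) = nbr_count G X v" if "X \<subseteq> S" "v \<in> S" for X v
  proof -
    have "inj_on f X" using inj_on_subset[OF inj] that assms(2) by blast
    then show ?thesis
      using that assms(2) unfolding nbr_count_def
      by (subst sum.reindex) (auto intro!: sum.cong simp: arcs subset_iff)
  qed
  have "Y \<in> gf2_kernel H (f ` S) \<longleftrightarrow>
      (\<exists>X. X \<subseteq> S \<and> (\<forall>v\<in>S. even (nbr_count H (f ` X) (f v))) \<and> Y = f ` X)" for Y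
    by (auto simp: gf2_kernel_def subset_image_iff)
  then have "Y \<in> gf2_kernel H (f ` S) \<longleftrightarrow> (\<exists>X. X \<in> gf2_kernel G S \<and> Y = f ` X)" for Y
    using count unfolding gf2_kernel_def mem_Collect_eq by metis
  then have "gf2_kernel H (f ` S) = (`) f ` gf2_kernel G S"
    by blast
  moreover have "inj_on ((`) f) (gf2_kernel G S)"
    by (rule inj_on_subset[OF inj_on_image_Pow[OF inj]]) (use assms(2) in \<open>auto simp: gf2_kernel_def\<close>)
  ultimately show ?thesis
    by (intro gf2_nullity_eqI) (simp add: card_image)
qed

section \<open>Nullities under pivoting\<close>

context
  fixes G :: "'a pair_pre_digraph" and a b :: 'a
  assumes G: "G \<in> nonempty_graphs" and ab: "(a, b) \<in> parcs G"
begin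

interpretation pair_graph G
  using G by (simp add: nonempty_graphs_def)

lemma parcs_sym: "(x, y) \<in> parcs G \<longleftrightarrow> (y, x) \<in> parcs G"
  using arcs_symmetric by blast

lemma pivot_endpoints: "a \<noteq> b" "a \<in> pverts G" "b \<in> pverts G" "(b, a) \<in> parcs G"
    "(a, a) \<notin> parcs G" "(b, b) \<notin> parcs G"
  using ab no_loops' parcs_sym wellformed' by auto

text \<open>Pivoting toggles only pairs disjoint from \<open>{a, b}\<close>, so rows
  \<open>a\<close> and \<open>b\<close> of the matrix stay the same.\<close>

lemma nbr_count_pivot_endpoint:
  assumes "v \<in> {a, b}"
  shows "nbr_count (pivot G a b) Y v = nbr_count G Y v"
  using assms unfolding nbr_count_def
  by (intro sum.cong) (auto simp: pivot_def pivot_pairs_def)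

(* Toggling {v, y} whenever v and y lie in different classes adds the determinant of the two
   incidence vectors to the adjacency matrix over GF(2). *)
lemma even_nbr_count_pivot:
  assumes "Y \<subseteq> pverts G - {a, b}" "v \<in> pverts G - {a, b}"
  shows "even (nbr_count (pivot G a b) Y v) \<longleftrightarrow>
    even (nbr_count G Y v + of_bool ((v, a) \<in> parcs G) * nbr_count G Y b
      + of_bool ((v, b) \<in> parcs G) * nbr_count G Y a)"
proof -
  have "even (nbr_count (pivot G a b) Y v) \<longleftrightarrow>
    even (\<Sum>y\<in>Y. of_bool ((v, y) \<in> parcs G)
      + of_bool ((v, a) \<in> parcs G) * of_bool ((b, y) \<in> parcs G)
      + of_bool ((v, b) \<in> parcs G) * of_bool ((a, y) \<in> parcs G) :: nat)"
    unfolding nbr_count_def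
  proof (rule even_sum_cong)
    fix y assume "y \<in> Y"
    then show "even (of_bool ((v, y) \<in> parcs (pivot G a b)) :: nat) \<longleftrightarrow>
      even (of_bool ((v, y) \<in> parcs G)
        + of_bool ((v, a) \<in> parcs G) * of_bool ((b, y) \<in> parcs G)
        + of_bool ((v, b) \<in> parcs G) * of_bool ((a, y) \<in> parcs G) :: nat)"
      using assms parcs_sym[of b y] parcs_sym[of a y]
      by (auto simp: pivot_def pivot_pairs_def pivot_class_def)
  qed
  then show ?thesis
    by (simp add: nbr_count_def sum.distrib sum_distrib_left del: sum_of_bool_eq)
qed

text \<open>The block of the matrix on \<open>{a, b}\<close> is the invertible swap matrix, and its
  Schur complement is the matrix of the pivot on \<open>R\<close>.\<close>

lemma gf2_nullity_pivot_both:
  assumes R: "R \<subseteq> pverts G - {a, b}"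
  shows "gf2_nullity (pivot G a b) R = gf2_nullity G (insert a (insert b R))"
proof -
  \<comment> \<open>Row \<open>a\<close> meets \<open>b\<close> but not \<open>a\<close>, so it
    fixes the coordinate at \<open>b\<close> from the count of \<open>Y\<close> at \<open>a\<close>.
    Row \<open>b\<close> likewise fixes the coordinate at \<open>a\<close>; hence the crossing. Thus
    \<open>ext Y\<close> is the only extension of \<open>Y\<close> that satisfies both rows.\<close>
  define ext where "ext Y = Y \<union> {x. x = a \<and> odd (nbr_count G Y b) \<or> x = b \<and> odd (nbr_count G Y a)}"
    for Y
  have fin: "finite X" if "X \<subseteq> insert a (insert b R)" for X
    using that R pair_finite_verts by (meson finite.insertI finite_Diff finite_subset)
  have count: "nbr_count G X v = nbr_count G (X - {a, b}) v
      + of_bool (a \<in> X) * of_bool ((v, a) \<in> parcs G) + of_bool (b \<in> X) * of_bool ((v, b) \<in> parcs G)"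
    if "X \<subseteq> insert a (insert b R)" for X v
    using nbr_count_remove[of X G v a] nbr_count_remove[of "X - {a}" G v b] fin[OF that]
      pivot_endpoints(1) by (auto simp: Diff_insert2[symmetric] insert_commute)
  have R_ab: "a \<notin> R" "b \<notin> R" using R by auto
  have ext: "ext Y \<subseteq> insert a (insert b R)" "ext Y - {a, b} = Y"
    "a \<in> ext Y \<longleftrightarrow> odd (nbr_count G Y b)" "b \<in> ext Y \<longleftrightarrow> odd (nbr_count G Y a)"
    if "Y \<subseteq> R" for Y
    using that R_ab pivot_endpoints(1) by (auto simp: ext_def)
  have ker: "X \<in> gf2_kernel G (insert a (insert b R)) \<longleftrightarrow>
      X - {a, b} \<in> gf2_kernel (pivot G a b) R \<and> X = ext (X - {a, b})" for X
  proof (cases "X \<subseteq> insert a (insert b R)")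
    case True
    then have sub: "X - {a, b} \<subseteq> R" by auto
    have eq: "X = ext (X - {a, b}) \<longleftrightarrow>
      (a \<in> X \<longleftrightarrow> odd (nbr_count G (X - {a, b}) b)) \<and> (b \<in> X \<longleftrightarrow> odd (nbr_count G (X - {a, b}) a))"
      using ext[OF sub] by auto
    have "even (nbr_count G X a) \<longleftrightarrow> (b \<in> X \<longleftrightarrow> odd (nbr_count G (X - {a, b}) a))"
      "even (nbr_count G X b) \<longleftrightarrow> (a \<in> X \<longleftrightarrow> odd (nbr_count G (X - {a, b}) b))"
      using pivot_endpoints ab by (auto simp: count[OF True])
    \<comment> \<open>With these coordinates, the contributions of \<open>a\<close> and
      \<open>b\<close> to row \<open>v\<close> are the correction terms of
      \<open>even_nbr_count_pivot\<close>.\<close>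
    moreover have "even (nbr_count (pivot G a b) (X - {a, b}) v) \<longleftrightarrow> even (nbr_count G X v)"
      if "v \<in> R" "a \<in> X \<longleftrightarrow> odd (nbr_count G (X - {a, b}) b)"
        "b \<in> X \<longleftrightarrow> odd (nbr_count G (X - {a, b}) a)" for v
    proof -
      define Y where "Y = X - {a, b}"
      have "Y \<subseteq> pverts G - {a, b}" "v \<in> pverts G - {a, b}"
        using sub R that(1) by (auto simp: Y_def)
      from even_nbr_count_pivot[OF this] show ?thesis
        using that(2,3) unfolding count[OF True, of v] Y_def[symmetric]
        by (cases "a \<in> X"; cases "b \<in> X"; cases "(v, a) \<in> parcs G"; cases "(v, b) \<in> parcs G") simp_all
    qed
    ultimately show ?thesis
      unfolding eq gf2_kernel_def mem_Collect_eq ball_simps using True sub by blast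
  next
    case False
    then show ?thesis
      using ext(1)[of "X - {a, b}"] by (auto simp: gf2_kernel_def)
  qed
  have "bij_betw ext (gf2_kernel (pivot G a b) R) (gf2_kernel G (insert a (insert b R)))"
  proof (rule bij_betw_byWitness[where f' = "\<lambda>X. X - {a, b}"])
    show "\<forall>Y\<in>gf2_kernel (pivot G a b) R. ext Y - {a, b} = Y"
      using ext(2) by (auto simp: gf2_kernel_def)
    show "\<forall>X\<in>gf2_kernel G (insert a (insert b R)). ext (X - {a, b}) = X"
      using ker by metis
    show "ext ` gf2_kernel (pivot G a b) R \<subseteq> gf2_kernel G (insert a (insert b R))"
      using ker ext(2) by (auto simp: gf2_kernel_def)
    show "(\<lambda>X. X - {a, b}) ` gf2_kernel G (insert a (insert b R)) \<subseteq> gf2_kernel (pivot G a b) R"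
      using ker by blast
  qed
  then show ?thesis
    by (intro gf2_nullity_eqI bij_betw_same_card)
qed

text \<open>Row \<open>a\<close> is the same condition in both graphs and makes the count at
  \<open>a\<close> even. In any other row the pivot then adds only the count at \<open>b\<close>
  times the entry in column \<open>a\<close>, which a change of the coordinate at \<open>a\<close>
  absorbs.\<close>

lemma gf2_nullity_pivot_one:
  assumes R: "R \<subseteq> pverts G - {a, b}"
  shows "gf2_nullity (pivot G a b) (insert a R) = gf2_nullity G (insert a R)"
proof -
  \<comment> \<open>The coordinate at \<open>a\<close> is toggled exactly when the rest of
    \<open>X\<close> has odd count at \<open>b\<close>.\<close>
  define flip where
    "flip X = (X - {a}) \<union> {x. x = a \<and> (a \<in> X \<longleftrightarrow> even (nbr_count G (X - {a}) b))}" for X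
  have flip: "flip X - {a} = X - {a}"
    "a \<in> flip X \<longleftrightarrow> (a \<in> X \<longleftrightarrow> even (nbr_count G (X - {a}) b))" for X
    by (auto simp: flip_def)
  \<comment> \<open>The toggling condition reads only \<open>X - {a}\<close>, which
    \<open>flip\<close> preserves, so \<open>flip\<close> is an involution.\<close>
  have flip_flip: "flip (flip X) = X" for X
    using flip[of X] flip[of "flip X"] by auto
  have flip_sub: "flip X \<subseteq> insert a R \<longleftrightarrow> X \<subseteq> insert a R" for X
    using flip(1)[of X] by auto
  have fin: "finite X" if "X \<subseteq> insert a R" for X
    using that R pair_finite_verts by (meson finite.insertI finite_Diff finite_subset)
  have va: "(v, a) \<in> parcs (pivot G a b) \<longleftrightarrow> (v, a) \<in> parcs G" for v
    by (auto simp: pivot_def pivot_pairs_def)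
  have ker: "flip X \<in> gf2_kernel (pivot G a b) (insert a R) \<longleftrightarrow> X \<in> gf2_kernel G (insert a R)" for X
  proof (cases "X \<subseteq> insert a R")
    case True
    then have sub: "X - {a} \<subseteq> pverts G - {a, b}" using R by auto
    have count: "nbr_count (pivot G a b) (flip X) v = nbr_count (pivot G a b) (X - {a}) v
        + of_bool (a \<in> flip X) * of_bool ((v, a) \<in> parcs G)"
      "nbr_count G X v = nbr_count G (X - {a}) v + of_bool (a \<in> X) * of_bool ((v, a) \<in> parcs G)" for v
      using nbr_count_remove[of X G v a] nbr_count_remove[of "flip X" "pivot G a b" v a]
        fin True flip_sub flip(1) va by auto
    have "even (nbr_count (pivot G a b) (flip X) a) \<longleftrightarrow> even (nbr_count G (X - {a}) a)"
      "even (nbr_count G X a) \<longleftrightarrow> even (nbr_count G (X - {a}) a)"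
      using count[of a] nbr_count_pivot_endpoint[of a] pivot_endpoints by auto
    moreover have "even (nbr_count (pivot G a b) (flip X) v) \<longleftrightarrow> even (nbr_count G X v)"
      if "v \<in> R" "even (nbr_count G (X - {a}) a)" for v
    proof -
      have "v \<in> pverts G - {a, b}"
        using R that(1) by auto
      from even_nbr_count_pivot[OF sub this] show ?thesis
        using that(2) flip(2)[of X] unfolding count[of v]
        by (cases "a \<in> X"; cases "a \<in> flip X"; cases "(v, a) \<in> parcs G"; cases "(v, b) \<in> parcs G") simp_all
    qed
    ultimately show ?thesis
      unfolding gf2_kernel_def mem_Collect_eq ball_simps using True flip_sub by blast
  next
    case False
    then show ?thesis
      using flip_sub by (auto simp: gf2_kernel_def)
  qed
  have "bij_betw flip (gf2_kernel G (insert a R)) (gf2_kernel (pivot G a b) (insert a R))"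
    using ker flip_flip by (intro bij_betw_byWitness[where f' = flip]) (auto, metis)
  then show ?thesis
    by (metis bij_betw_same_card gf2_nullity_eqI)
qed

text \<open>This is the edge recursion for an arbitrary weight \<open>\<phi>\<close>. Sets avoiding
  \<open>a\<close> give the first sum; those containing \<open>a\<close> are matched with subsets of
  \<open>pverts G - {b}\<close> in the pivot.\<close>

lemma sum_gf2_nullity_pivot:
  fixes \<phi> :: "nat \<Rightarrow> 'b :: comm_monoid_add"
  shows "(\<Sum>S\<in>Pow (pverts G). \<phi> (gf2_nullity G S)) =
    (\<Sum>S\<in>Pow (pverts G - {a}). \<phi> (gf2_nullity G S)) +
    (\<Sum>S\<in>Pow (pverts G - {b}). \<phi> (gf2_nullity (pivot G a b) S))"
proof -
  have split: "(\<Sum>S\<in>Pow (insert v V). f S) = (\<Sum>S\<in>Pow V. f S) + (\<Sum>S\<in>Pow V. f (insert v S))"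
    if "finite V" "v \<notin> V" for v V and f :: "'a set \<Rightarrow> 'b"
  proof -
    have "inj_on (insert v) (Pow V)"
      using that(2) by (auto simp: inj_on_def)
    then show ?thesis
      using that by (subst Pow_insert, subst sum.union_disjoint) (auto simp: sum.reindex)
  qed
  define R where "R = pverts G - {a, b}"
  have R: "finite R" "a \<notin> R" "b \<notin> R" "pverts G = insert a (insert b R)"
    "pverts G - {a} = insert b R" "pverts G - {b} = insert a R" "a \<notin> insert b R"
    using pivot_endpoints by (auto simp: R_def)
  \<comment> \<open>The matching crosses over: for \<open>T \<subseteq> R\<close>, the set
    \<open>T\<close> on the left goes to \<open>insert a T\<close> on the right, and
    \<open>insert b T\<close> goes to \<open>T\<close>. Hence the commutation of the two
    sums.\<close>
  have "(\<Sum>S\<in>Pow (insert b R). \<phi> (gf2_nullity G (insert a S))) =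
    (\<Sum>S\<in>Pow (insert a R). \<phi> (gf2_nullity (pivot G a b) S))"
    using R(1-3) gf2_nullity_pivot_one gf2_nullity_pivot_both
    by (simp add: split R_def add.commute)
  then show ?thesis
    \<comment> \<open>The differences are rewritten first, since \<open>R(4)\<close> would also
      rewrite the \<open>pverts G\<close> inside them.\<close>
    unfolding R(5,6) unfolding R(4) using R(1,7) by (simp add: split)
qed

end

section \<open>Powers of x - 1 in the free module\<close>

(* With x_n read as the power x^n and the constant term dropped, this is (x - 1)^n. *)
function shifted_power :: "nat \<Rightarrow> (nat \<Rightarrow>\<^sub>0 int)" where
  "shifted_power n = (if n = 0 then 0 else frag_of n)
     - (\<Sum>S\<in>Pow {..<n} - {{..<n}}. shifted_power (card S))"
  by auto
termination
proof (relation "measure id")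
  fix n :: nat and S :: "nat set"
  assume "S \<in> Pow {..<n} - {{..<n}}"
  then have "card S < card {..<n}"
    by (intro psubset_card_mono) auto
  then show "(card S, n) \<in> measure id" by simp
qed simp

declare shifted_power.simps [simp del]

text \<open>This is the binomial expansion of ((x - 1) + 1)^n. The recursion is its instance
  \<open>{..<n}\<close> solved for the top term, and a bijection transports it to \<open>V\<close>.
  For empty \<open>V\<close> the sum is 0, because the constant term is dropped.\<close>

lemma sum_shifted_power:
  assumes "finite V" "V \<noteq> {}"
  shows "(\<Sum>S\<in>Pow V. shifted_power (card S)) = frag_of (card V)"
proof -
  obtain f where f: "bij_betw f {..<card V} V"
    using assms(1) bij_betw_from_nat_into_finite by blast
  then have inj: "inj_on f S" if "S \<subseteq> {..<card V}" for S
    using that by (meson bij_betw_def inj_on_subset)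
  have "(\<Sum>S\<in>Pow V. shifted_power (card S)) = (\<Sum>S\<in>Pow {..<card V}. shifted_power (card (f ` S)))"
    by (rule sum.reindex_bij_betw[OF bij_betw_Pow[OF f], symmetric])
  also have "\<dots> = (\<Sum>S\<in>Pow {..<card V}. shifted_power (card S))"
    using inj by (intro sum.cong) (auto simp: card_image)
  also have "\<dots> = shifted_power (card V) +
    (\<Sum>S\<in>Pow {..<card V} - {{..<card V}}. shifted_power (card S))"
    by (subst sum.remove[of _ "{..<card V}"]) auto
  also have "\<dots> = frag_of (card V)"
    using assms by (subst shifted_power.simps) simp
  finally show ?thesis .
qed

lemma keys_shifted_power: "Poly_Mapping.keys (shifted_power n) \<subseteq> {1..}"
proof (induction n rule: shifted_power.induct)
  case (1 n)
  have "Poly_Mapping.keys (\<Sum>S\<in>Pow {..<n} - {{..<n}}. shifted_power (card S)) \<subseteq> {1..}"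
    using 1 by (intro order_trans[OF keys_sum]) blast
  moreover have "Poly_Mapping.keys (if n = 0 then 0 else frag_of n) \<subseteq> {1..}"
    by auto
  ultimately show ?case
    by (subst shifted_power.simps) (meson Un_least keys_diff order_trans)
qed

section \<open>Existence of the interlace map\<close>

definition interlace :: "'a pair_pre_digraph \<Rightarrow> (nat \<Rightarrow>\<^sub>0 int)" where
  "interlace = (\<lambda>G\<in>nonempty_graphs. \<Sum>S\<in>Pow (pverts G). shifted_power (gf2_nullity G S))"

text \<open>The recursion never leaves the nonempty graphs: the other endpoint of the edge survives
  each deletion.\<close>

lemma edge_deletions_nonempty_graphs:
  assumes G: "G \<in> nonempty_graphs" and ab: "(a, b) \<in> parcs G"
  shows "delete_vertex G a \<in> nonempty_graphs" "delete_vertex (pivot G a b) b \<in> nonempty_graphs"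
proof -
  note ends = pivot_endpoints[OF G ab]
  show "delete_vertex G a \<in> nonempty_graphs"
    using delete_vertex_nonempty_graphs[OF G ends(3)] ends by auto
  show "delete_vertex (pivot G a b) b \<in> nonempty_graphs"
    using delete_vertex_nonempty_graphs[OF pivot_nonempty_graphs[OF G], of a a b b] ends
    by (auto simp: pivot_def)
qed

lemma interlace_map_interlace: "interlace_map interlace"
  unfolding interlace_map_def
proof (intro conjI ballI allI impI)
  have "interlace G \<in> carrier (free_Abelian_group {1..})" if "G \<in> nonempty_graphs"
    for G :: "'a pair_pre_digraph"
    using that keys_shifted_power unfolding interlace_def carrier_free_Abelian_group_iff
    by (simp del: One_nat_def) (intro order_trans[OF keys_sum] UN_least)
  then show "(interlace :: 'a pair_pre_digraph \<Rightarrow> _)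
      \<in> nonempty_graphs \<rightarrow>\<^sub>E carrier (free_Abelian_group {1..})"
    by (intro PiE_I) (auto simp: interlace_def)
next
  fix G :: "'a pair_pre_digraph" and a b
  assume G: "G \<in> nonempty_graphs" and ab: "(a, b) \<in> parcs G"
  \<comment> \<open>Only the vertex set of the smaller graph is unfolded, so that
    \<open>gf2_nullity_delete_vertex\<close> still matches.\<close>
  have "interlace (delete_vertex G a) = (\<Sum>S\<in>Pow (pverts G - {a}). shifted_power (gf2_nullity G S))"
    using edge_deletions_nonempty_graphs[OF G ab] unfolding interlace_def restrict_def
    by (auto intro!: sum.cong arg_cong[where f = shifted_power] gf2_nullity_delete_vertex
        simp: delete_vertex_def[of G a, THEN arg_cong[where f = pverts]])
  moreover have "interlace (delete_vertex (pivot G a b) b) =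
      (\<Sum>S\<in>Pow (pverts G - {b}). shifted_power (gf2_nullity (pivot G a b) S))"
    using edge_deletions_nonempty_graphs[OF G ab] unfolding interlace_def restrict_def
    by (auto intro!: sum.cong arg_cong[where f = shifted_power] gf2_nullity_delete_vertex
        simp: delete_vertex_def[of "pivot G a b" b, THEN arg_cong[where f = pverts]]
          pivot_def[of G a b, THEN arg_cong[where f = pverts]])
  ultimately show "interlace G = interlace (delete_vertex G a) + interlace (delete_vertex (pivot G a b) b)"
    using sum_gf2_nullity_pivot[OF G ab, of shifted_power] G by (simp add: interlace_def)
next
  fix G :: "'a pair_pre_digraph"
  assume G: "G \<in> nonempty_graphs" and edgeless: "parcs G = {}"
  then interpret pair_graph G by (simp add: nonempty_graphs_def)
  have "interlace G = (\<Sum>S\<in>Pow (pverts G). shifted_power (card S))"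
    using G edgeless gf2_nullity_edgeless[OF edgeless] finite_subset[OF _ pair_finite_verts]
    by (auto simp: interlace_def intro!: sum.cong)
  then show "interlace G = frag_of (card (pverts G))"
    using G sum_shifted_power[OF pair_finite_verts] by (simp add: nonempty_graphs_def)
qed

section \<open>Uniqueness and isomorphism invariance\<close>

text \<open>Induction on the number of vertices: pivoting keeps the vertex set, so any edge reduces
  the value to two graphs with one vertex fewer.\<close>

lemma interlace_map_unique:
  fixes q r :: "'a pair_pre_digraph \<Rightarrow> (nat \<Rightarrow>\<^sub>0 int)"
  assumes q: "interlace_map q" and r: "interlace_map r"
  shows "q = r"
proof -
  have "q G = r G" if "G \<in> nonempty_graphs" for G
    using that
  proof (induction "card (pverts G)" arbitrary: G rule: less_induct)
    case less
    show ?case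
    proof (cases "parcs G = {}")
      case True
      then show ?thesis using q r less.prems by (auto simp: interlace_map_def)
    next
      case False
      then obtain a b where ab: "(a, b) \<in> parcs G" by auto
      note ends = pivot_endpoints[OF less.prems ab]
      have fin: "finite (pverts G)"
        using less.prems pair_fin_digraph.pair_finite_verts
        by (auto simp: nonempty_graphs_def pair_graph_def pair_digraph_def)
      have "q (delete_vertex G a) = r (delete_vertex G a)"
        "q (delete_vertex (pivot G a b) b) = r (delete_vertex (pivot G a b) b)"
        using edge_deletions_nonempty_graphs[OF less.prems ab] card_Diff1_less[OF fin] ends
        by (auto intro!: less.hyps simp: delete_vertex_def[THEN arg_cong[where f = pverts]]
            pivot_def[THEN arg_cong[where f = pverts]] simp del: card_Diff_insert)
      then show ?thesis
        using q r less.prems ab by (auto simp: interlace_map_def)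
    qed
  qed
  \<comment> \<open>Outside the nonempty graphs both maps are \<open>undefined\<close> by
    extensionality.\<close>
  then show ?thesis
    using q r by (auto simp: interlace_map_def intro: PiE_ext)
qed

text \<open>The closed formula involves only nullities of vertex sets, which an isomorphism
  preserves. By uniqueness this covers every map with the required properties.\<close>

lemma interlace_iso:
  assumes G: "G \<in> nonempty_graphs" and H: "H \<in> nonempty_graphs"
    and iso: "digraph_iso (with_proj G) (with_proj H)"
  shows "interlace G = interlace H"
proof -
  obtain h where h: "pre_digraph.digraph_isomorphism (with_proj G) h" "with_proj H = app_iso h (with_proj G)"
    using iso by (auto simp: digraph_iso_def)
  define f where "f = iso_verts h"
  interpret pair_graph G using G by (simp add: nonempty_graphs_def)
  have inj: "inj_on f (pverts G)"
    using h(1) by (simp add: digraph_isomorphism_def f_def)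
  have verts: "pverts H = f ` pverts G"
    using arg_cong[OF h(2), of verts] by (simp add: f_def)
  \<comment> \<open>The isomorphism \<open>h\<close> acts on arcs by a map of its own; passing to
    \<open>arcs_ends\<close> expresses the arcs of \<open>H\<close> through the vertex map
    \<open>f\<close> alone.\<close>
  have "parcs H = arcs_ends (app_iso h (with_proj G))"
    using arg_cong[OF h(2), of arcs_ends] by simp
  also have "\<dots> = (\<lambda>e. (f (fst e), f (snd e))) ` parcs G"
    using h(1) unfolding arcs_ends_def arc_to_ends_def app_iso_simps image_image
    by (intro image_cong) (auto simp: digraph_isomorphism_def f_def)
  finally have arcs: "parcs H = (\<lambda>e. (f (fst e), f (snd e))) ` parcs G" .
  have "(f x, f y) \<in> parcs H \<longleftrightarrow> (x, y) \<in> parcs G" if "x \<in> pverts G" "y \<in> pverts G" for x y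
  proof
    assume "(f x, f y) \<in> parcs H"
    then obtain u v where uv: "(u, v) \<in> parcs G" "f x = f u" "f y = f v"
      by (auto simp: arcs)
    then have "u \<in> pverts G" "v \<in> pverts G"
      using wellformed' by auto
    then show "(x, y) \<in> parcs G"
      using uv that inj by (auto dest: inj_onD)
  qed (force simp: arcs)
  then have null: "gf2_nullity H (f ` S) = gf2_nullity G S" if "S \<subseteq> pverts G" for S
    using that by (intro gf2_nullity_image[OF inj])
  have "bij_betw ((`) f) (Pow (pverts G)) (Pow (pverts H))"
    using inj verts by (intro bij_betw_Pow) (simp add: bij_betw_def)
  then have "(\<Sum>S\<in>Pow (pverts H). shifted_power (gf2_nullity H S)) =
      (\<Sum>S\<in>Pow (pverts G). shifted_power (gf2_nullity H (f ` S)))"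
    by (rule sum.reindex_bij_betw[symmetric])
  then show ?thesis
    using G H null by (simp add: interlace_def)
qed

theorem theorem15:
  shows "(\<exists>!q :: 'a pair_pre_digraph \<Rightarrow> (nat \<Rightarrow>\<^sub>0 int). interlace_map q) \<and>
    (\<forall>q :: 'a pair_pre_digraph \<Rightarrow> (nat \<Rightarrow>\<^sub>0 int). interlace_map q \<longrightarrow>
      (\<forall>G\<in>nonempty_graphs. \<forall>H\<in>nonempty_graphs.
         digraph_iso (with_proj G) (with_proj H) \<longrightarrow> q G = q H))"
  using interlace_map_interlace interlace_map_unique interlace_iso by metis

end
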